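(* Let $\rho$ be a density operator on $\mathbb{C}^2\otimes\mathbb{C}^2$, and put $a_i=\mathrm{Tr}(\rho\,\sigma_i\otimes\mathbf 1)$, $b_i=\mathrm{Tr}(\rho\,\mathbf 1\otimes\sigma_i)$, $c_{ij}=\mathrm{Tr}(\rho\,\sigma_i\otimes\sigma_j)$ for $i,j\in\{1,2,3\}$, with $a^2=\sum_i a_i^2$ and $b^2=\sum_i b_i^2$. If $\rho$ is separable, then both inequalities $$\sum_{i,j=1}^{3}c_{ij}^2\leq 1+|a^2-b^2|\qquad\text{and}\qquad \sum_{i,j=1}^{3}c_{ij}^2\leq 1-|a^2-b^2|$$ hold.
   Context: $\sigma_1,\sigma_2,\sigma_3$ are the Pauli matrices $\sigma_x,\sigma_y,\sigma_z$. A density operator is a positive semidefinite operator of trace one. Every density operator on $\mathbb{C}^2\otimes\mathbb{C}^2$ can be written $\rho=\frac14\bigl(\mathbf 1\otimes\mathbf 1+\mathbf a\cdot\boldsymbol\sigma\otimes\mathbf 1+\mathbf 1\otimes\mathbf b\cdot\boldsymbol\sigma+\sum_{ij}c_{ij}\,\sigma_i\otimes\sigma_j\bigr)$ with $\mathbf a=(a_i)$, $\mathbf b=(b_i)$ (the Bloch vectors of the two reduced states) and $c_{ij}$ as in the statement. $\rho$ is separable if $\rho=\sum_k\lambda_k\,\rho^1_k\otimes\rho^2_k$ for some finite collection of $\lambda_k\ge 0$ with $\sum_k\lambda_k=1$ and density operators $\rho^1_k,\rho^2_k$ on $\mathbb{C}^2$. *)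

theory Defs
  imports "HOL-Analysis.Analysis"
begin

definition hermitian_adjoint :: "complex^'n^'m \<Rightarrow> complex^'m^'n" where
  "hermitian_adjoint A = map_matrix cnj (transpose A)"

definition hermitian :: "complex^'n^'n \<Rightarrow> bool" where
  "hermitian A \<longleftrightarrow> hermitian_adjoint A = A"

(* The library's inner product on complex vectors is the real one, so the
   Hermitian inner product is introduced here (antilinear in the first argument). *)
definition cinner :: "complex^'n \<Rightarrow> complex^'n \<Rightarrow> complex" where
  "cinner v w = (\<Sum>i\<in>UNIV. cnj (v $ i) * w $ i)"

(* For a Hermitian matrix the quadratic form is real-valued; Re is only a coercion. *)
definition positive_semidefinite :: "complex^'n^'n \<Rightarrow> bool" where
  "positive_semidefinite A \<longleftrightarrow> hermitian A \<and> (\<forall>v. 0 \<le> Re (cinner v (A *v v)))"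

definition density_operator :: "complex^'n^'n \<Rightarrow> bool" where
  "density_operator \<rho> \<longleftrightarrow> positive_semidefinite \<rho> \<and> trace \<rho> = 1"

(* The tensor product of the coordinate spaces over 'n and 'p is the coordinate space
   over 'n \<times> 'p, with the basis vector e_i \<otimes> e_k indexed by (i, k). *)
definition tensor_op :: "complex^'n^'m \<Rightarrow> complex^'q^'p \<Rightarrow> complex^('n::finite \<times> 'q::finite)^('m::finite \<times> 'p::finite)"
    (infixr "\<otimes>" 75) where
  "A \<otimes> B = (\<chi> r s. A $ fst r $ fst s * B $ snd r $ snd s)"

definition separable :: "complex^('n::finite \<times> 'p::finite)^('n \<times> 'p) \<Rightarrow> bool" where
  "separable \<rho> \<longleftrightarrow>
     (\<exists>(N::nat) (l :: nat \<Rightarrow> real) (\<rho>1 :: nat \<Rightarrow> complex^'n^'n) (\<rho>2 :: nat \<Rightarrow> complex^'p^'p).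
        (\<forall>k<N. 0 \<le> l k \<and> density_operator (\<rho>1 k) \<and> density_operator (\<rho>2 k)) \<and>
        (\<Sum>k<N. l k) = 1 \<and>
        \<rho> = (\<Sum>k<N. l k *\<^sub>R (\<rho>1 k \<otimes> \<rho>2 k)))"

(* The type 3 has exactly the elements 1, 2 and 3. *)
definition pauli :: "3 \<Rightarrow> complex^2^2" where
  "pauli i =
     (if i = 1 then vector [vector [0, 1], vector [1, 0]]
      else if i = 2 then vector [vector [0, - \<i>], vector [\<i>, 0]]
      else vector [vector [1, 0], vector [0, - 1]])"

lemma hermitian_iff: "hermitian A \<longleftrightarrow> (\<forall>i j. cnj (A $ j $ i) = A $ i $ j)"
  by (simp add: hermitian_def hermitian_adjoint_def map_matrix_def transpose_def vec_eq_iff)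

lemma hermitian_mat_1: "hermitian (mat 1)"
  by (simp add: hermitian_iff mat_def)

lemma hermitian_pauli: "hermitian (pauli i)"
  by (simp add: hermitian_iff pauli_def forall_2)

lemma hermitian_tensor_op: "hermitian A \<Longrightarrow> hermitian B \<Longrightarrow> hermitian (A \<otimes> B)"
  by (simp add: hermitian_iff tensor_op_def)

(* Hence taking real parts of expectation values of Hermitian observables loses nothing. *)
lemma trace_hermitian_mult_real:
  assumes "hermitian A" "hermitian B"
  shows "complex_of_real (Re (trace (A ** B))) = trace (A ** B)"
proof -
  have "cnj (trace (A ** B)) = (\<Sum>i\<in>UNIV. \<Sum>k\<in>UNIV. A $ k $ i * B $ i $ k)"
    using assms by (simp add: hermitian_iff trace_def matrix_matrix_mult_def)
  also have "\<dots> = trace (A ** B)"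
    unfolding trace_def matrix_matrix_mult_def by (subst sum.swap) simp
  finally show ?thesis
    by (metis Reals_cnj_iff of_real_Re)
qed

end

theory Submission
  imports Defs
begin

text \<open>A separable state is a mixture of products of qubit states with Bloch vectors \<open>x k\<close> and
  \<open>y k\<close> in the unit ball. Writing \<open>X = x k \<bullet> x m\<close> and \<open>Y = y k \<bullet> y m\<close>, the quantity
  \<open>\<Sum>c\<^sup>2 + a\<^sup>2 - b\<^sup>2 - 1\<close> is the average over \<open>k\<close> and \<open>m\<close> of \<open>X * Y + X - Y - 1 = (X - 1) * (Y + 1)\<close>,
  which is nonpositive because \<open>\<bar>X\<bar>\<close> and \<open>\<bar>Y\<bar>\<close> are at most \<open>1\<close>. The other sign follows by symmetry,
  and the bound with \<open>1 + \<bar>a\<^sup>2 - b\<^sup>2\<bar>\<close> is weaker than the one with \<open>1 - \<bar>a\<^sup>2 - b\<^sup>2\<bar>\<close>.\<close>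

lemma trace_scaleR: "trace (r *\<^sub>R A) = r *\<^sub>R trace (A :: complex^'n^'n)"
  by (simp add: trace_def scaleR_sum_right)

lemma trace_sum: "trace (\<Sum>k\<in>S. f k) = (\<Sum>k\<in>S. trace (f k :: complex^'n^'n))"
  unfolding trace_def sum_component by (rule sum.swap)

lemma matrix_mult_sum_left: "(\<Sum>k\<in>S. f k) ** (B :: complex^'p^'n) = (\<Sum>k\<in>S. f k ** B)"
  by (simp add: matrix_matrix_mult_def vec_eq_iff sum_distrib_right sum.swap[of _ S UNIV])

lemma matrix_mult_scaleR_left: "(r *\<^sub>R A) ** (B :: complex^'p^'n) = r *\<^sub>R (A ** B)"
  by (simp add: matrix_matrix_mult_def vec_eq_iff scaleR_sum_right)

lemma sum_UNIV_prod: "(\<Sum>p\<in>UNIV. f p) = (\<Sum>i\<in>UNIV. \<Sum>j\<in>UNIV. f (i, j))"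
  by (simp add: sum.cartesian_product)

lemma trace_tensor_mult:
  "trace ((A \<otimes> B) ** (C \<otimes> D)) = trace (A ** C) * trace (B ** D)"
  by (simp add: trace_def matrix_matrix_mult_def tensor_op_def sum_UNIV_prod sum_product mult_ac)

text \<open>\<open>Re\<close> is not multiplicative in general. Here the trace in the first slot is
  real, as \<open>A\<close> and \<open>C\<close> are Hermitian, and one real factor lets
  \<open>Re\<close> split the product.\<close>

lemma Re_trace_tensor_mult:
  assumes "hermitian A" "hermitian C"
  shows "Re (trace ((A \<otimes> B) ** (C \<otimes> D))) = Re (trace (A ** C)) * Re (trace (B ** D))"
proof -
  have "Im (trace (A ** C)) = 0"
    using trace_hermitian_mult_real[OF assms] by (metis Im_complex_of_real)
  then show ?thesis
    by (simp add: trace_tensor_mult)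
qed

text \<open>Taking \<open>C\<close> and \<open>D\<close> to be Pauli matrices or
  \<open>mat 1\<close> yields all three families \<open>a\<close>, \<open>b\<close> and
  \<open>c\<close> from this one formula.\<close>

lemma Re_trace_mixture_mult:
  assumes "\<And>k. k \<in> S \<Longrightarrow> hermitian (A k)" "hermitian C"
  shows "Re (trace ((\<Sum>k\<in>S. l k *\<^sub>R (A k \<otimes> B k)) ** (C \<otimes> D)))
       = (\<Sum>k\<in>S. l k * (Re (trace (A k ** C)) * Re (trace (B k ** D))))"
  by (simp add: matrix_mult_sum_left trace_sum matrix_mult_scaleR_left trace_scaleR
      Re_trace_tensor_mult assms)

definition bloch :: "complex^2^2 \<Rightarrow> real^3" where
  "bloch A = (\<chi> i. Re (trace (A ** pauli i)))"

lemma density_operator_det_nonneg: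
  fixes A :: "complex^2^2"
  assumes "density_operator A"
  shows "(cmod (A $ 1 $ 2))\<^sup>2 \<le> Re (A $ 1 $ 1) * Re (A $ 2 $ 2)"
proof -
  define p q r where "p = A $ 1 $ 1" and "q = A $ 2 $ 2" and "r = A $ 1 $ 2"
  have psd: "0 \<le> Re (cinner v (A *v v))" for v
    using assms by (simp add: density_operator_def positive_semidefinite_def)
  have "hermitian A" "trace A = 1"
    using assms by (simp_all add: density_operator_def positive_semidefinite_def)
  then have h: "A $ 2 $ 1 = cnj r" "Im p = 0" "Im q = 0" "p + q = 1"
    by (simp_all add: hermitian_iff p_def q_def r_def trace_def sum_2)
      (metis Reals_cnj_iff complex_is_Real_iff)+
  have pq: "Re p + Re q = 1"
    using h(4) by (metis plus_complex.simps(1) one_complex.simps(1))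
  \<comment> \<open>The two test vectors are the columns of the adjugate of \<open>A\<close>; they give
    \<open>det A\<close> times either diagonal entry, and the diagonal entries add up to \<open>1\<close>.\<close>
  have "0 \<le> Re p * (Re p * Re q - (cmod r)\<^sup>2)"
    using psd[of "vector [- r, p]"] h
    by (simp add: cinner_def matrix_vector_mult_def sum_2 p_def[symmetric] q_def[symmetric]
        r_def[symmetric] cmod_power2) (simp add: algebra_simps power2_eq_square)
  moreover have "0 \<le> Re q * (Re p * Re q - (cmod r)\<^sup>2)"
    using psd[of "vector [q, - cnj r]"] h
    by (simp add: cinner_def matrix_vector_mult_def sum_2 p_def[symmetric] q_def[symmetric]
        r_def[symmetric] cmod_power2) (simp add: algebra_simps power2_eq_square)
  ultimately have "0 \<le> (Re p + Re q) * (Re p * Re q - (cmod r)\<^sup>2)"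
    by (simp add: distrib_right)
  then show ?thesis
    unfolding pq by (simp add: p_def q_def r_def)
qed

text \<open>With off-diagonal entry \<open>r\<close> and diagonal \<open>p\<close>,
  \<open>q\<close>, the Bloch vector is \<open>(2 * Re r, - 2 * Im r, p - q)\<close>. Its squared
  length is the squared trace minus four times the determinant, and the determinant is
  nonnegative.\<close>

lemma norm_bloch_le_1:
  assumes "density_operator A"
  shows "norm (bloch A) \<le> 1"
proof -
  define p q r where "p = Re (A $ 1 $ 1)" and "q = Re (A $ 2 $ 2)" and "r = A $ 1 $ 2"
  have "hermitian A" "trace A = 1"
    using assms by (simp_all add: density_operator_def positive_semidefinite_def)
  then have h: "A $ 2 $ 1 = cnj r" "A $ 1 $ 1 + A $ 2 $ 2 = 1"
    by (simp_all add: hermitian_iff r_def trace_def sum_2)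
  have pq: "p + q = 1"
    using h(2) unfolding p_def q_def by (metis plus_complex.simps(1) one_complex.simps(1))
  have "(norm (bloch A))\<^sup>2 = 4 * (cmod r)\<^sup>2 + (p - q)\<^sup>2"
    unfolding norm_vec_def L2_set_def
    by (simp add: bloch_def sum_3 pauli_def trace_def matrix_matrix_mult_def sum_2 h(1)
        r_def[symmetric] p_def[symmetric] q_def[symmetric] cmod_power2)
  also have "\<dots> \<le> 4 * (p * q) + (p - q)\<^sup>2"
    using density_operator_det_nonneg[OF assms] by (simp add: p_def q_def r_def)
  also have "\<dots> = (p + q)\<^sup>2"
    by (simp add: power2_eq_square algebra_simps)
  finally show ?thesis
    by (simp add: pq power_le_one_iff abs_square_le_1)
qed

lemma sum_squares_mixture:
  fixes x :: "nat \<Rightarrow> real^'n"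
  shows "(\<Sum>i\<in>UNIV. (\<Sum>k\<in>S. l k * x k $ i)\<^sup>2) = (\<Sum>k\<in>S. \<Sum>m\<in>S. l k * l m * (x k \<bullet> x m))"
proof -
  have "(\<Sum>i\<in>UNIV. (\<Sum>k\<in>S. l k * x k $ i)\<^sup>2) = (\<Sum>k\<in>S. l k *\<^sub>R x k) \<bullet> (\<Sum>k\<in>S. l k *\<^sub>R x k)"
    by (simp add: inner_vec_def power2_eq_square)
  also have "\<dots> = (\<Sum>k\<in>S. \<Sum>m\<in>S. l k * l m * (x k \<bullet> x m))"
    by (simp add: inner_sum_left inner_sum_right sum_distrib_left inner_commute mult_ac)
  finally show ?thesis .
qed

text \<open>The left side is the squared Hilbert-Schmidt norm of a mixture of rank-one matrices, and
  the inner product of two such matrices factors into the two vector inner products.\<close>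

lemma sum_squares_correlation_mixture:
  fixes x :: "nat \<Rightarrow> real^'n" and y :: "nat \<Rightarrow> real^'p"
  shows "(\<Sum>i\<in>UNIV. \<Sum>j\<in>UNIV. (\<Sum>k\<in>S. l k * (x k $ i * y k $ j))\<^sup>2)
       = (\<Sum>k\<in>S. \<Sum>m\<in>S. l k * l m * ((x k \<bullet> x m) * (y k \<bullet> y m)))"
proof -
  have "(\<Sum>i\<in>UNIV. \<Sum>j\<in>UNIV. (\<Sum>k\<in>S. l k * (x k $ i * y k $ j))\<^sup>2)
      = (\<Sum>i\<in>UNIV. \<Sum>k\<in>S. \<Sum>m\<in>S. (l k * x k $ i) * (l m * x m $ i) * (y k \<bullet> y m))"
    \<comment> \<open>For fixed \<open>i\<close>, the entry \<open>x k $ i\<close> is absorbed into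
      the weight, so the sum over \<open>j\<close> is the vector case for \<open>y\<close>.\<close>
    using sum_squares_mixture[of "\<lambda>k. l k * x k $ i" y S for i] by (simp add: mult.assoc)
  also have "\<dots> = (\<Sum>k\<in>S. \<Sum>m\<in>S. \<Sum>i\<in>UNIV. (l k * x k $ i) * (l m * x m $ i) * (y k \<bullet> y m))"
    by (subst sum.swap, rule sum.cong[OF refl], rule sum.swap)
  also have "\<dots> = (\<Sum>k\<in>S. \<Sum>m\<in>S. l k * l m * ((x k \<bullet> x m) * (y k \<bullet> y m)))"
    by (simp add: inner_vec_def[of "x _"] sum_distrib_left sum_distrib_right mult_ac)
  finally show ?thesis .
qed

lemma abs_inner_le_1:
  assumes "norm x \<le> 1" "norm y \<le> 1"
  shows "\<bar>x \<bullet> y\<bar> \<le> 1"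
  by (rule order_trans[OF Cauchy_Schwarz_ineq2 mult_le_one]) (use assms in auto)

lemma correlation_mixture_bound:
  fixes x :: "nat \<Rightarrow> real^'n" and y :: "nat \<Rightarrow> real^'p"
  assumes l: "\<And>k. k \<in> S \<Longrightarrow> 0 \<le> l k" "(\<Sum>k\<in>S. l k) = 1"
    and x: "\<And>k. k \<in> S \<Longrightarrow> norm (x k) \<le> 1" and y: "\<And>k. k \<in> S \<Longrightarrow> norm (y k) \<le> 1"
  shows "(\<Sum>i\<in>UNIV. \<Sum>j\<in>UNIV. (\<Sum>k\<in>S. l k * (x k $ i * y k $ j))\<^sup>2)
       \<le> 1 - \<bar>(\<Sum>i\<in>UNIV. (\<Sum>k\<in>S. l k * x k $ i)\<^sup>2) - (\<Sum>j\<in>UNIV. (\<Sum>k\<in>S. l k * y k $ j)\<^sup>2)\<bar>"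
proof -
  define X Y where "X k m = x k \<bullet> x m" and "Y k m = y k \<bullet> y m" for k m
  \<comment> \<open>\<open>E f\<close> is the expectation of \<open>f\<close> at two indices drawn
    independently with weights \<open>l\<close>.\<close>
  define E where "E f = (\<Sum>k\<in>S. \<Sum>m\<in>S. l k * l m * f k m)" for f :: "nat \<Rightarrow> nat \<Rightarrow> real"
  have E1: "E (\<lambda>k m. 1) = 1"
    using l(2) by (simp add: E_def sum_product[symmetric])
  have XY: "\<bar>X k m\<bar> \<le> 1" "\<bar>Y k m\<bar> \<le> 1" if "k \<in> S" "m \<in> S" for k m
    using that by (simp_all add: X_def Y_def abs_inner_le_1 x y)
  \<comment> \<open>\<open>P\<close> and \<open>Q\<close> stay general so that the bound can be used
    for \<open>X\<close>, \<open>Y\<close> in both orders, one for each sign inside the absolute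
    value.\<close>
  have nonpos: "E (\<lambda>k m. (P k m - 1) * (Q k m + 1)) \<le> 0"
    if "\<And>k m. k \<in> S \<Longrightarrow> m \<in> S \<Longrightarrow> \<bar>P k m\<bar> \<le> 1 \<and> \<bar>Q k m\<bar> \<le> 1" for P Q
    unfolding E_def
  proof (intro sum_nonpos)
    fix k m assume km: "k \<in> S" "m \<in> S"
    then have "(P k m - 1) * (Q k m + 1) \<le> 0"
      using that[of k m] by (intro mult_nonpos_nonneg) (auto simp: abs_le_iff)
    then show "l k * l m * ((P k m - 1) * (Q k m + 1)) \<le> 0"
      using km l(1) by (intro mult_nonneg_nonpos[of "l k * l m"]) auto
  qed
  have expand: "E (\<lambda>k m. (P k m - 1) * (Q k m + 1)) = E (\<lambda>k m. P k m * Q k m) + E P - E Q - E (\<lambda>k m. 1)" for P Q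
    by (simp add: E_def algebra_simps sum.distrib sum_subtractf)
  have "E (\<lambda>k m. X k m * Y k m) + E X - E Y \<le> 1" "E (\<lambda>k m. X k m * Y k m) + E Y - E X \<le> 1"
    using nonpos[of X Y] nonpos[of Y X] XY by (simp_all add: expand E1 mult.commute)
  then have "E (\<lambda>k m. X k m * Y k m) \<le> 1 - \<bar>E X - E Y\<bar>"
    by linarith
  then show ?thesis
    by (simp add: sum_squares_mixture sum_squares_correlation_mixture E_def X_def Y_def)
qed

theorem proposition6:
  fixes \<rho> :: "complex^(2 \<times> 2)^(2 \<times> 2)"
    and a b :: "3 \<Rightarrow> real"
    and c :: "3 \<Rightarrow> 3 \<Rightarrow> real"
  assumes "density_operator \<rho>"
    and "\<And>i. a i = Re (trace (\<rho> ** (pauli i \<otimes> mat 1)))"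
    and "\<And>i. b i = Re (trace (\<rho> ** (mat 1 \<otimes> pauli i)))"
    and "\<And>i j. c i j = Re (trace (\<rho> ** (pauli i \<otimes> pauli j)))"
    and "separable \<rho>"
  shows "(\<Sum>i\<in>UNIV. \<Sum>j\<in>UNIV. (c i j)\<^sup>2)
           \<le> 1 + \<bar>(\<Sum>i\<in>UNIV. (a i)\<^sup>2) - (\<Sum>i\<in>UNIV. (b i)\<^sup>2)\<bar> \<and>
         (\<Sum>i\<in>UNIV. \<Sum>j\<in>UNIV. (c i j)\<^sup>2)
           \<le> 1 - \<bar>(\<Sum>i\<in>UNIV. (a i)\<^sup>2) - (\<Sum>i\<in>UNIV. (b i)\<^sup>2)\<bar>"
proof -
  obtain N l and \<rho>1 \<rho>2 :: "nat \<Rightarrow> complex^2^2" where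
    D: "\<And>k. k < N \<Longrightarrow> 0 \<le> l k" "\<And>k. k < N \<Longrightarrow> density_operator (\<rho>1 k)"
      "\<And>k. k < N \<Longrightarrow> density_operator (\<rho>2 k)"
    and l: "(\<Sum>k<N. l k) = 1" and \<rho>: "\<rho> = (\<Sum>k<N. l k *\<^sub>R (\<rho>1 k \<otimes> \<rho>2 k))"
    using assms(5) unfolding separable_def by blast
  have h: "hermitian (\<rho>1 k)" "trace (\<rho>1 k) = 1" "trace (\<rho>2 k) = 1" if "k < N" for k
    using D(2,3)[OF that] by (simp_all add: density_operator_def positive_semidefinite_def)
  \<comment> \<open>A slot measured with \<open>mat 1\<close> contributes the trace of its state,
    which is 1, so only the Bloch entry of the other slot remains.\<close>
  have a: "a i = (\<Sum>k<N. l k * bloch (\<rho>1 k) $ i)" for i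
    unfolding assms(2) \<rho> by (subst Re_trace_mixture_mult) (simp_all add: h hermitian_pauli bloch_def)
  have b: "b i = (\<Sum>k<N. l k * bloch (\<rho>2 k) $ i)" for i
    unfolding assms(3) \<rho> by (subst Re_trace_mixture_mult) (simp_all add: h hermitian_mat_1 bloch_def)
  have c: "c i j = (\<Sum>k<N. l k * (bloch (\<rho>1 k) $ i * bloch (\<rho>2 k) $ j))" for i j
    unfolding assms(4) \<rho> by (subst Re_trace_mixture_mult) (simp_all add: h hermitian_pauli bloch_def)
  have "(\<Sum>i\<in>UNIV. \<Sum>j\<in>UNIV. (c i j)\<^sup>2)
      \<le> 1 - \<bar>(\<Sum>i\<in>UNIV. (a i)\<^sup>2) - (\<Sum>i\<in>UNIV. (b i)\<^sup>2)\<bar>"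
    unfolding a b c
    by (rule correlation_mixture_bound) (use D l in \<open>auto intro: norm_bloch_le_1\<close>)
  then show ?thesis
    by linarith
qed

end
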